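(* All scrambled sets of the dynamical system $(X,T)$ (defined in the context as an inverse limit of substitution subshifts) are finite or countable.
   Context: For $n\ge1$ let $A_n=\{0,\dots,n\}$ and let $\tau_n:A_n\to A_n^3$ be the primitive substitution $\tau_n(a)=a\,0\,(a+1)$ if $a\ne n$ and $\tau_n(n)=n\,0\,n$, extended to finite words by concatenation. $X_n$ is the smallest subshift (closed shift-invariant subset) of $A_n^{\mathbb Z}$ in which all words $\tau_n^k(a)$, $k\ge0$, $a\in A_n$, appear. $T_n$ is the shift $T_n((x_i)_i)=(x_{i+1})_i$ on $X_n$. Let $\rho_n:A_{n+1}\to A_n$, $\rho_n(a)=a$ if $a\ne n+1$ and $\rho_n(n+1)=n$; applied coordinatewise it defines a factor map $\rho_n:X_{n+1}\to X_n$. Let $$X=\{(x_n)_{n\ge1}\in\prod_{n\ge1}X_n:\ \rho_n(x_{n+1})=x_n\ \ \forall n\ge1\},\qquad T((x_n)_{n\ge1})=(T_n(x_n))_{n\ge1},$$ with a metric $\varrho$ compatible with the product topology. A pair $\{x,y\}\subseteq X$ is a Li–Yorke pair if $\limsup_{k\to\infty}\varrho(T^kx,T^ky)>0$ and $\liminf_{k\to\infty}\varrho(T^kx,T^ky)=0$. A set $S\subseteq X$ is scrambled if any pair of distinct points of $S$ is a Li–Yorke pair. *)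

theory Defs
  imports "HOL-Analysis.Analysis"
begin

section \<open>The substitution subshifts\<close>

definition alphabet :: "nat \<Rightarrow> nat set" where
  "alphabet n = {0..n}"

definition subst_letter :: "nat \<Rightarrow> nat \<Rightarrow> nat list" where
  "subst_letter n a = (if a \<noteq> n then [a, 0, a + 1] else [n, 0, n])"

definition subst_word :: "nat \<Rightarrow> nat list \<Rightarrow> nat list" where
  "subst_word n w = concat (map (subst_letter n) w)"

definition full_shift :: "nat \<Rightarrow> (int \<Rightarrow> nat) set" where
  "full_shift n = {x. \<forall>i. x i \<in> alphabet n}"

definition shift :: "(int \<Rightarrow> nat) \<Rightarrow> (int \<Rightarrow> nat)" where
  "shift x = (\<lambda>i. x (i + 1))"

text \<open>Closedness is taken in the topology of pointwise convergence on
  \<^typ>\<open>int \<Rightarrow> nat\<close> with \<^typ>\<open>nat\<close> discrete. The full shift is closed there, so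
  this agrees with closedness in the product topology of the full shift.\<close>

definition subshift :: "nat \<Rightarrow> (int \<Rightarrow> nat) set \<Rightarrow> bool" where
  "subshift n Y \<longleftrightarrow> Y \<subseteq> full_shift n \<and> closed Y \<and> shift ` Y = Y"

definition appears_in :: "nat list \<Rightarrow> (int \<Rightarrow> nat) set \<Rightarrow> bool" where
  "appears_in w Y \<longleftrightarrow> (\<exists>x\<in>Y. \<exists>i. \<forall>j<length w. x (i + int j) = w ! j)"

text \<open>The smallest subshift is rendered as the intersection of all subshifts in which
  the words appear; the family is nonempty, as it contains the full shift.\<close>

definition subst_shift :: "nat \<Rightarrow> (int \<Rightarrow> nat) set" where
  "subst_shift n = \<Inter>{Y. subshift n Y \<and>
      (\<forall>k. \<forall>a\<in>alphabet n. appears_in ((subst_word n ^^ k) [a]) Y)}"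

section \<open>The inverse limit\<close>

definition collapse :: "nat \<Rightarrow> nat \<Rightarrow> nat" where
  "collapse n a = (if a \<noteq> n + 1 then a else n)"

text \<open>Sequences are indexed by \<open>n \<ge> 1\<close>; the index 0 carries the dummy value
  \<^term>\<open>undefined\<close>, as usual for \<^const>\<open>PiE\<close>.\<close>

definition limit_space :: "(nat \<Rightarrow> int \<Rightarrow> nat) set" where
  "limit_space = {x \<in> (\<Pi>\<^sub>E n\<in>{1..}. subst_shift n). \<forall>n\<ge>1. collapse n \<circ> x (n + 1) = x n}"

definition limit_map :: "(nat \<Rightarrow> int \<Rightarrow> nat) \<Rightarrow> (nat \<Rightarrow> int \<Rightarrow> nat)" where
  "limit_map x = (\<lambda>n\<in>{1..}. shift (x n))"

definition limit_topology :: "(nat \<Rightarrow> int \<Rightarrow> nat) topology" where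
  "limit_topology =
     subtopology (product_topology (\<lambda>n. top_of_set (subst_shift n)) {1..}) limit_space"

section \<open>Li--Yorke pairs and scrambled sets\<close>

definition li_yorke_pair :: "'a set \<Rightarrow> ('a \<Rightarrow> 'a \<Rightarrow> real) \<Rightarrow> ('a \<Rightarrow> 'a) \<Rightarrow> 'a \<Rightarrow> 'a \<Rightarrow> bool" where
  "li_yorke_pair X d T x y \<longleftrightarrow> x \<in> X \<and> y \<in> X \<and>
     limsup (\<lambda>k. ereal (d ((T ^^ k) x) ((T ^^ k) y))) > 0 \<and>
     liminf (\<lambda>k. ereal (d ((T ^^ k) x) ((T ^^ k) y))) = 0"

definition scrambled :: "'a set \<Rightarrow> ('a \<Rightarrow> 'a \<Rightarrow> real) \<Rightarrow> ('a \<Rightarrow> 'a) \<Rightarrow> 'a set \<Rightarrow> bool" where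
  "scrambled X d T S \<longleftrightarrow> S \<subseteq> X \<and> (\<forall>x\<in>S. \<forall>y\<in>S. x \<noteq> y \<longrightarrow> li_yorke_pair X d T x y)"

end

theory Submission
  imports Defs
begin

text \<open>
  All the substitutions have constant length 3 and a coincidence (the middle letter of every
  image is 0), so each \<open>X\<^sub>n\<close> is an almost one-to-one extension of the 3-adic odometer. The
  odometer point below a sequence is its phase: a family \<open>z k\<close> of integers, coherent modulo
  \<open>3 ^ k\<close>, such that cutting the sequence at the positions congruent to \<open>- z k\<close> modulo
  \<open>3 ^ k\<close> exhibits it as a concatenation of \<open>k\<close>-fold images of letters.

  A Li--Yorke pair comes arbitrarily close, so its points share arbitrarily long words at equal
  positions. The phase can be read off from such words (\<open>phase_unique\<close>), and the maps \<open>\<rho>\<^sub>n\<close>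
  preserve it, so all points of a scrambled set \<open>S\<close> have one common phase, the same at every
  level \<open>n\<close>.

  It remains to see that a fibre over the odometer is countable. Suppose that two points with
  phase \<open>z\<close> differ at position \<open>i\<close> of some level. Follow the starts of the blocks of length
  \<open>3 ^ k\<close> that contain \<open>i\<close>. The points differ at each of them, so the block is never the
  middle third of the next one; whenever it is the last third, the smaller of the two letters
  drops by one. Hence the starts become constant, at an integer \<open>i\<^sub>0\<close> with \<open>i\<^sub>0 + z k\<close>
  divisible by \<open>3 ^ k\<close> for every \<open>k\<close>, and the points differ at \<open>i\<^sub>0\<close> as well
  (\<open>origin_exists\<close>). At most one integer has this divisibility, so \<open>i\<^sub>0\<close> depends on \<open>z\<close>
  alone: a point of the fibre is determined by its letters at \<open>i\<^sub>0\<close> on all levels. As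
  \<open>\<rho>\<^sub>n\<close> truncates letters at \<open>n\<close>, these letters encode one element of
  \<open>\<nat> \<union> {\<infinity>}\<close>, which leaves countably many points.
\<close>

section \<open>Sequences that can be desubstituted\<close>

text \<open>The positions \<open>3 ^ j * q - z\<close> carry the \<open>j\<close>-fold desubstitution of \<open>x\<close>, because the
  first letter of the image of \<open>a\<close> is \<open>a\<close> itself. The condition thus says that each of the
  first \<open>k\<close> desubstitutions is the image of the next one. Stated for the coordinates of \<open>x\<close>
  alone, it visibly defines a closed set.\<close>

definition aligned :: "nat \<Rightarrow> int \<Rightarrow> nat \<Rightarrow> (int \<Rightarrow> nat) set" where
  "aligned n z k = {x \<in> full_shift n. \<forall>j<k. \<forall>q.
     x (3 ^ j * q - z) = subst_letter n (x (3 ^ Suc j * (q div 3) - z)) ! nat (q mod 3)}"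

lemma subst_letter_nth [simp]:
  "subst_letter n b ! 0 = b"
  "subst_letter n b ! Suc 0 = 0"
  "subst_letter n b ! 2 = (if b = n then n else b + 1)"
  by (auto simp: subst_letter_def numeral_2_eq_2)

lemma mod3_cases:
  fixes q :: int
  obtains "q mod 3 = 0" | "q mod 3 = 1" | "q mod 3 = 2"
  using pos_mod_bound[of 3 q] pos_mod_sign[of 3 q] by linarith

lemma aligned_le: "x \<in> aligned n z k \<Longrightarrow> x i \<le> n"
  by (auto simp: aligned_def full_shift_def alphabet_def)

lemma aligned_step:
  "x \<in> aligned n z k \<Longrightarrow> j < k \<Longrightarrow>
     x (3 ^ j * q - z) = subst_letter n (x (3 ^ Suc j * (q div 3) - z)) ! nat (q mod 3)"
  unfolding aligned_def by blast

lemma aligned_antimono: "j \<le> k \<Longrightarrow> aligned n z k \<subseteq> aligned n z j"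
  unfolding aligned_def by auto

text \<open>Translating \<open>z\<close> by a multiple of \<open>3 ^ k\<close> translates the \<open>j\<close>-fold desubstitution, for
  \<open>j < k\<close>, by a multiple of 3, which is compatible with its division into images of letters.
  So only the residue of \<open>z\<close> modulo \<open>3 ^ k\<close> matters.\<close>

lemma aligned_add_power: "x \<in> aligned n z k \<Longrightarrow> x \<in> aligned n (z + 3 ^ k * t) k"
proof -
  assume x: "x \<in> aligned n z k"
  have "x (3 ^ j * q - (z + 3 ^ k * t)) =
      subst_letter n (x (3 ^ Suc j * (q div 3) - (z + 3 ^ k * t))) ! nat (q mod 3)" if "j < k" for j q
  proof -
    obtain r where k: "k = Suc (j + r)"
      using less_imp_Suc_add[OF \<open>j < k\<close>] by blast
    define q' where "q' = q - 3 * (3 ^ r * t)"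
    have "q' mod 3 = q mod 3" "q' div 3 = q div 3 - 3 ^ r * t"
      unfolding q'_def by presburger+
    moreover have "3 ^ j * q - (z + 3 ^ k * t) = 3 ^ j * q' - z"
      by (simp add: k q'_def power_add algebra_simps)
    moreover have "3 ^ Suc j * (q div 3) - (z + 3 ^ k * t) = 3 ^ Suc j * (q div 3 - 3 ^ r * t) - z"
      by (simp add: k power_add algebra_simps)
    ultimately show ?thesis
      using aligned_step[OF x \<open>j < k\<close>, of q'] by (simp only:)
  qed
  then show ?thesis
    using x unfolding aligned_def by blast
qed

lemma aligned_cong: "x \<in> aligned n z k \<Longrightarrow> 3 ^ k dvd z - z' \<Longrightarrow> x \<in> aligned n z' k"
proof -
  assume x: "x \<in> aligned n z k" and "3 ^ k dvd z - z'"
  then obtain t where "z - z' = 3 ^ k * t" by (auto elim: dvdE)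
  then have "z' = z + 3 ^ k * (- t)" by simp
  then show ?thesis using aligned_add_power[OF x] by metis
qed

lemma shift_aligned_iff: "shift x \<in> aligned n (z + 1) k \<longleftrightarrow> x \<in> aligned n z k"
proof -
  have "(\<forall>i. x (i + 1) \<in> alphabet n) \<longleftrightarrow> (\<forall>i. x i \<in> alphabet n)"
    by (metis diff_add_cancel)
  then show ?thesis
    by (simp add: aligned_def full_shift_def shift_def algebra_simps)
qed

lemma closed_full_shift: "closed (full_shift n)"
proof -
  have "full_shift n = (\<Inter>i. {x. x i \<in> alphabet n})"
    by (auto simp: full_shift_def)
  moreover have "closed {x :: int \<Rightarrow> nat. x i \<in> alphabet n}" for i
  proof -
    have "closed ((\<lambda>x :: int \<Rightarrow> nat. x i) -` alphabet n)"
      by (intro closed_vimage) (auto intro!: finite_imp_closed simp: alphabet_def)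
    then show ?thesis by (simp add: vimage_def)
  qed
  ultimately show ?thesis by auto
qed

lemma closed_aligned: "closed (aligned n z k)"
proof -
  have eq: "aligned n z k = full_shift n \<inter> (\<Inter>j\<in>{..<k}. \<Inter>q. {x.
     x (3 ^ j * q - z) = subst_letter n (x (3 ^ Suc j * (q div 3) - z)) ! nat (q mod 3)})"
    by (auto simp: aligned_def)
  have "continuous_on UNIV (\<lambda>x. f (x i))" for f :: "nat \<Rightarrow> nat" and i :: int
    using continuous_on_compose2[of UNIV f UNIV "\<lambda>x. x i"] by auto
  then show ?thesis
    unfolding eq by (intro closed_Int closed_INT ballI closed_full_shift closed_Collect_eq) auto
qed

section \<open>Points of the substitution subshift have a phase\<close>

text \<open>For \<open>0 \<le> m < 3 ^ k\<close> this is letter number \<open>m\<close> of the \<open>k\<close>-fold image of \<open>a\<close>. Allowing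
  every integer \<open>m\<close> extends this word to the periodic sequence that repeats it.\<close>

fun subst_coord :: "nat \<Rightarrow> nat \<Rightarrow> nat \<Rightarrow> int \<Rightarrow> nat" where
  "subst_coord n a 0 m = a"
| "subst_coord n a (Suc k) m = subst_letter n (subst_coord n a k (m div 3)) ! nat (m mod 3)"

lemma subst_coord_le: "a \<le> n \<Longrightarrow> subst_coord n a k m \<le> n"
proof (induction k arbitrary: m)
  case (Suc k)
  then have "subst_coord n a k (m div 3) \<le> n" by simp
  then show ?case by (cases m rule: mod3_cases) auto
qed simp

lemma subst_coord_power_mult: "subst_coord n a (j + r) (3 ^ j * q) = subst_coord n a r q"
  by (induction j) (auto simp: mult.assoc)

text \<open>The image of \<open>a\<close> begins with \<open>a\<close>, so the \<open>j\<close>-fold image of \<open>a\<close> is a prefix of all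
  later ones.\<close>

lemma subst_coord_extend:
  "0 \<le> m \<Longrightarrow> m < 3 ^ j \<Longrightarrow> subst_coord n a (j + r) m = subst_coord n a j m"
proof (induction j arbitrary: m)
  case 0
  have "subst_coord n a r 0 = a" by (induction r) auto
  moreover have "m = 0" using 0 by simp
  ultimately show ?case by simp
next
  case (Suc j)
  then have "subst_coord n a (j + r) (m div 3) = subst_coord n a j (m div 3)"
    by (intro Suc.IH) auto
  then show ?case by simp
qed

lemma length_subst_word: "length (subst_word n w) = 3 * length w"
  by (induction w) (auto simp: subst_word_def subst_letter_def)

lemma subst_word_nth:
  "m < 3 * length w \<Longrightarrow> subst_word n w ! m = subst_letter n (w ! (m div 3)) ! (m mod 3)"
proof (induction w arbitrary: m)
  case (Cons b w)
  have len: "length (subst_letter n b) = 3" by (simp add: subst_letter_def)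
  show ?case
  proof (cases "m < 3")
    case True
    then show ?thesis by (simp add: subst_word_def nth_append len)
  next
    case False
    then obtain r where r: "m = r + 3" by (metis add.commute le_Suc_ex not_less)
    then have "subst_word n w ! r = subst_letter n (w ! (r div 3)) ! (r mod 3)"
      using Cons by auto
    then show ?thesis by (simp add: subst_word_def nth_append len r)
  qed
qed simp

lemma iterate_nth:
  "length ((subst_word n ^^ k) [a]) = 3 ^ k \<and>
   (\<forall>m<3 ^ k. (subst_word n ^^ k) [a] ! m = subst_coord n a k (int m))"
proof (induction k)
  case (Suc k)
  have "(subst_word n ^^ Suc k) [a] ! m = subst_coord n a (Suc k) (int m)" if m: "m < 3 ^ Suc k" for m
  proof -
    have "m div 3 < 3 ^ k" using m by auto
    moreover have "int m div 3 = int (m div 3)" "nat (int m mod 3) = m mod 3"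
      by (auto simp: zdiv_int nat_mod_distrib)
    ultimately show ?thesis
      using Suc m by (simp add: subst_word_nth)
  qed
  then show ?case using Suc by (simp add: length_subst_word)
qed simp

lemma subst_coord_aligned:
  assumes "a \<le> n" "k \<le> K"
  shows "subst_coord n a K \<in> aligned n 0 k"
proof -
  have "subst_coord n a K (3 ^ j * q) =
      subst_letter n (subst_coord n a K (3 ^ Suc j * (q div 3))) ! nat (q mod 3)" if "j < k" for j q
  proof -
    obtain r where K: "K = Suc (j + r)"
      using less_imp_Suc_add[of j K] \<open>j < k\<close> \<open>k \<le> K\<close> by auto
    show ?thesis
      using subst_coord_power_mult[of n a j "Suc r" q] subst_coord_power_mult[of n a "Suc j" r "q div 3"]
      by (simp add: K del: power_Suc)
  qed
  then show ?thesis
    using assms by (simp add: aligned_def full_shift_def alphabet_def subst_coord_le)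
qed

text \<open>Since \<open>z\<close> matters only modulo \<open>3 ^ k\<close>, the aligned sequences with a given \<open>k\<close> form a
  finite union of closed sets, which is a subshift. It contains the periodic sequences
  \<open>subst_coord n a K\<close> for \<open>K \<ge> k\<close>, hence all the words that define the smallest
  subshift.\<close>

lemma subst_shift_aligned:
  assumes "x \<in> subst_shift n"
  obtains z where "x \<in> aligned n z k"
proof -
  define Y where "Y = (\<Union>z. aligned n z k)"
  have Y_eq: "Y = (\<Union>z\<in>{0..<3 ^ k}. aligned n z k)"
  proof -
    have "x \<in> aligned n (z mod 3 ^ k) k" if "x \<in> aligned n z k" for x z
      by (rule aligned_cong[OF that]) (simp add: dvd_minus_mod)
    then show ?thesis
      unfolding Y_def by (fastforce simp: pos_mod_bound pos_mod_sign)
  qed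
  have "closed Y"
    unfolding Y_eq by (auto intro!: closed_UN closed_aligned)
  moreover have "shift ` Y = Y"
  proof (intro equalityI subsetI)
    fix x assume "x \<in> shift ` Y"
    then show "x \<in> Y" unfolding Y_def using shift_aligned_iff by blast
  next
    fix x assume "x \<in> Y"
    then obtain z where z: "x \<in> aligned n z k" unfolding Y_def by blast
    have x: "x = shift (\<lambda>i. x (i - 1))" by (simp add: shift_def)
    then have "(\<lambda>i. x (i - 1)) \<in> aligned n (z - 1) k"
      using shift_aligned_iff[of "\<lambda>i. x (i - 1)" n "z - 1" k] z by simp
    then show "x \<in> shift ` Y" unfolding Y_def using x by blast
  qed
  moreover have "Y \<subseteq> full_shift n" by (auto simp: Y_def aligned_def)
  moreover have "appears_in ((subst_word n ^^ j) [a]) Y" if "a \<in> alphabet n" for j a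
  proof -
    have "a \<le> n" using that by (simp add: alphabet_def)
    then have "subst_coord n a (j + k) \<in> Y"
      unfolding Y_def using subst_coord_aligned[of a n k "j + k"] by auto
    moreover have "subst_coord n a (j + k) (int m) = (subst_word n ^^ j) [a] ! m" if "m < 3 ^ j" for m
    proof -
      have "int m < 3 ^ j" using that by (metis of_nat_less_iff of_nat_numeral of_nat_power)
      then show ?thesis using iterate_nth[of j n a] that subst_coord_extend[of "int m" j n a k] by simp
    qed
    ultimately show ?thesis
      unfolding appears_in_def using iterate_nth[of j n a] by (metis add.left_neutral)
  qed
  ultimately have "Y \<in> {Y. subshift n Y \<and>
      (\<forall>k. \<forall>a\<in>alphabet n. appears_in ((subst_word n ^^ k) [a]) Y)}"
    by (simp add: subshift_def)
  then have "x \<in> Y"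
    using assms unfolding subst_shift_def by (rule InterD[rotated])
  then show ?thesis using that unfolding Y_def by blast
qed

section \<open>The phase is determined by long words\<close>

text \<open>This is how the proximality of a pair is used: it is the part of it that concerns one
  coordinate of the inverse limit, with the metric eliminated.\<close>

definition share_long_words :: "(int \<Rightarrow> nat) \<Rightarrow> (int \<Rightarrow> nat) \<Rightarrow> bool" where
  "share_long_words x y \<longleftrightarrow> (\<forall>L. \<exists>p. \<forall>i\<in>{p..p + L}. x i = y i)"

text \<open>In an image of a sequence the middle letters of blocks are 0 and the last letters are
  nonzero, so a 0 followed by a nonzero letter occurs exactly at the middle of a block.\<close>

lemma aligned_marker:
  assumes "x \<in> aligned n z (Suc k)" "1 \<le> n"
  shows "x (3 ^ k * q - z) = 0 \<and> x (3 ^ k * (q + 1) - z) \<noteq> 0 \<longleftrightarrow> q mod 3 = 1"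
proof (cases q rule: mod3_cases)
  case 1
  then have "(q + 1) mod 3 = 1" by presburger
  then show ?thesis using aligned_step[OF assms(1), of k "q + 1"] 1 by simp
next
  case 2
  then have "(q + 1) mod 3 = 2" by presburger
  then show ?thesis
    using aligned_step[OF assms(1), of k q] aligned_step[OF assms(1), of k "q + 1"] 2 \<open>1 \<le> n\<close> by simp
next
  case 3
  then show ?thesis using aligned_step[OF assms(1), of k q] \<open>1 \<le> n\<close> by simp
qed

text \<open>By induction, the phases agree modulo \<open>3 ^ k\<close>, so the \<open>k\<close>-fold desubstitutions of \<open>x\<close> and
  \<open>y\<close> also share long words, up to a translation by \<open>t\<close>. Any marker in such a word gives
  \<open>t\<close> modulo 3.\<close>

lemma phase_unique:
  assumes "x \<in> aligned n z k" "y \<in> aligned n z' k" "share_long_words x y" "1 \<le> n"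
  shows "3 ^ k dvd z - z'"
  using assms
proof (induction k)
  case (Suc k)
  have "x \<in> aligned n z k" "y \<in> aligned n z' k"
    using Suc.prems aligned_antimono[of k "Suc k"] by auto
  then have "3 ^ k dvd z - z'" using Suc by blast
  then obtain t where t: "z - z' = 3 ^ k * t" by (auto elim: dvdE)
  \<comment> \<open>A marker consists of two positions at distance \<open>3 ^ k\<close> and recurs with period
    \<open>3 * 3 ^ k\<close>; length \<open>5 * 3 ^ k\<close> leaves room for a complete one.\<close>
  obtain p where p: "\<And>i. p \<le> i \<Longrightarrow> i \<le> p + 5 * 3 ^ k \<Longrightarrow> x i = y i"
    using Suc.prems(3) unfolding share_long_words_def by (metis atLeastAtMost_iff)
  define P :: int where "P = 3 ^ k"
  have "P > 0" by (simp add: P_def)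
  define c where "c = (p + z) div (3 * P) + 1"
  have c: "p + z < 3 * P * c" "3 * P * c \<le> p + z + 3 * P"
  proof -
    have "3 * P * c = 3 * P * ((p + z) div (3 * P)) + 3 * P"
      by (simp add: c_def ring_distribs)
    then show "p + z < 3 * P * c" "3 * P * c \<le> p + z + 3 * P"
      using \<open>P > 0\<close> pos_mod_bound[of "3 * P" "p + z"] pos_mod_sign[of "3 * P" "p + z"]
        mult_div_mod_eq[of "3 * P" "p + z"]
      by linarith+
  qed
  define q where "q = 3 * c + 1"
  have "x (P * q - z) = y (P * q - z)" "x (P * (q + 1) - z) = y (P * (q + 1) - z)"
    using c \<open>P > 0\<close> by (auto intro!: p simp: q_def P_def[symmetric] algebra_simps)
  moreover have "q mod 3 = 1" by (simp add: q_def)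
  moreover have "P * q - z = P * (q - t) - z'" "P * (q + 1) - z = P * (q - t + 1) - z'"
    using t by (auto simp: P_def algebra_simps)
  ultimately have "(q - t) mod 3 = 1"
    using aligned_marker[OF Suc.prems(1,4), of q] aligned_marker[OF Suc.prems(2,4), of "q - t"]
    by (simp add: P_def)
  with \<open>q mod 3 = 1\<close> have "3 dvd t" by presburger
  then show ?case using t by (auto elim!: dvdE)
qed simp

lemma share_long_words_refl: "share_long_words x x"
  by (simp add: share_long_words_def)

text \<open>The letter maps \<open>\<rho>\<^sub>n\<close> intertwine the substitutions on \<open>n + 2\<close> and on \<open>n + 1\<close> letters,
  so they respect the division into blocks.\<close>

lemma aligned_collapse:
  assumes "x \<in> aligned (n + 1) z k"
  shows "collapse n \<circ> x \<in> aligned n z k"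
proof -
  have *: "collapse n (subst_letter (n + 1) b ! nat (q mod 3)) =
      subst_letter n (collapse n b) ! nat (q mod 3)" if "b \<le> n + 1" for b and q :: int
    using that by (cases q rule: mod3_cases) (auto simp: collapse_def)
  have "collapse n (x i) \<le> n" for i
    using aligned_le[OF assms, of i] by (auto simp: collapse_def)
  then show ?thesis
    using assms *[OF aligned_le[OF assms]]
    unfolding aligned_def by (simp add: full_shift_def alphabet_def)
qed

lemma limit_space_aligned_1:
  assumes "x \<in> limit_space" "1 \<le> n" "x n \<in> aligned n z k"
  shows "x 1 \<in> aligned 1 z k"
  using assms(2,3)
proof (induction n rule: dec_induct)
  case (step n)
  have "collapse n \<circ> x (n + 1) = x n"
    using assms(1) step by (auto simp: limit_space_def)
  then show ?case using step aligned_collapse[of "x (n + 1)" n z k] by simp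
qed

text \<open>The phase of \<open>y n\<close> is also a phase of \<open>y 1\<close>, and there it is unique. So sharing long words
  at the first level is enough to identify the phases at all levels.\<close>

lemma limit_space_phase:
  assumes "x \<in> limit_space" "y \<in> limit_space" "share_long_words (x 1) (y 1)"
    and "x 1 \<in> aligned 1 z k" "1 \<le> n"
  shows "y n \<in> aligned n z k"
proof -
  have "y n \<in> subst_shift n" using assms by (auto simp: limit_space_def)
  then obtain z' where z': "y n \<in> aligned n z' k" by (rule subst_shift_aligned)
  then have "y 1 \<in> aligned 1 z' k" by (rule limit_space_aligned_1[OF assms(2,5)])
  then have "3 ^ k dvd z - z'" using phase_unique assms by blast
  then show ?thesis
    using aligned_cong[OF z'] by (metis dvd_minus_iff minus_diff_eq)
qed

section \<open>Two points with the same phase\<close>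

lemma coherent_phase:
  assumes coh: "\<And>k. (3::int) ^ k dvd z (Suc k) - z k" and "j \<le> k"
  shows "3 ^ j dvd z k - (z j :: int)"
  using \<open>j \<le> k\<close>
proof (induction k rule: dec_induct)
  case (step k)
  have "(3::int) ^ j dvd 3 ^ k" using step by (simp add: le_imp_power_dvd)
  then have "3 ^ j dvd z (Suc k) - z k" by (rule dvd_trans) (rule coh)
  then have "3 ^ j dvd (z (Suc k) - z k) + (z k - z j)" using step by (intro dvd_add) auto
  then show ?case by simp
qed simp

text \<open>If the images of two letters differ at some place, then the letters differ, and the place
  is the first or the last one. At the first place the letters themselves appear. At the last
  place they appear increased by one, except that \<open>n\<close>, then the larger of the two, stays. So in
  passing from the block around \<open>i\<close> to the next larger one, the minimum of the two letters at
  its start drops unless the start is kept. A minimum that is least along the whole chain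
  therefore belongs to a start that is kept forever.\<close>

lemma origin_exists:
  assumes al: "\<And>k. x \<in> aligned n (z k) k" "\<And>k. y \<in> aligned n (z k) k"
    and coh: "\<And>k. (3::int) ^ k dvd z (Suc k) - z k"
    and diff: "x i \<noteq> y i"
  obtains i\<^sub>0 where "\<And>k. 3 ^ k dvd i\<^sub>0 + z k" "x i\<^sub>0 \<noteq> y i\<^sub>0"
proof -
  define b where "b k = i - (i + z k) mod 3 ^ k" for k
  have b_dvd: "3 ^ k dvd b k + z k" for k
  proof -
    have "b k + z k = (i + z k) - (i + z k) mod 3 ^ k" by (simp add: b_def)
    then show ?thesis by (simp only: dvd_minus_mod)
  qed
  \<comment> \<open>The digit \<open>d\<close> tells which third of the block of length \<open>3 ^ Suc k\<close> around \<open>i\<close> is the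
    block of length \<open>3 ^ k\<close> around \<open>i\<close>.\<close>
  have step: "\<exists>d. (d = 0 \<longrightarrow> b (Suc k) = b k) \<and> d \<in> {0, 1, 2} \<and>
      (\<forall>w. w \<in> aligned n (z (Suc k)) (Suc k) \<longrightarrow> w (b k) = subst_letter n (w (b (Suc k))) ! d)" for k
  proof -
    define P :: int where "P = 3 ^ k"
    have "P > 0" by (simp add: P_def)
    have "3 ^ k dvd (b k + z k) + (z (Suc k) - z k)" by (intro dvd_add b_dvd coh)
    then obtain q where q: "b k + z (Suc k) = P * q" by (auto elim!: dvdE simp: P_def)
    have "i + z (Suc k) = P * q + (i + z k) mod P" using q by (simp add: b_def P_def)
    moreover have "0 \<le> (i + z k) mod P" "(i + z k) mod P < P" using \<open>P > 0\<close> by auto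
    ultimately have "(i + z (Suc k)) div P = q" "(i + z (Suc k)) mod P = (i + z k) mod P"
      by (auto intro: int_div_pos_eq int_mod_pos_eq)
    then have "(i + z (Suc k)) mod (P * 3) = P * (q mod 3) + (i + z k) mod P"
      using zmod_zmult2_eq[of 3 "i + z (Suc k)" P] by simp
    then have bS: "b (Suc k) = b k - P * (q mod 3)"
      by (simp add: b_def P_def mult.commute)
    have "b k = 3 ^ k * q - z (Suc k)" using q by (simp add: P_def)
    moreover have "b (Suc k) = 3 ^ Suc k * (q div 3) - z (Suc k)"
    proof -
      have "P * q = P * (3 * (q div 3)) + P * (q mod 3)"
        by (metis distrib_left mult_div_mod_eq)
      then show ?thesis using bS q by (simp add: P_def algebra_simps)
    qed
    ultimately have letter: "w (b k) = subst_letter n (w (b (Suc k))) ! nat (q mod 3)"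
      if "w \<in> aligned n (z (Suc k)) (Suc k)" for w
      using aligned_step[OF that, of k q] by (simp only:)
    have digit: "nat (q mod 3) \<in> {0, 1, 2}" by (cases q rule: mod3_cases) auto
    have letters: "\<forall>w. w \<in> aligned n (z (Suc k)) (Suc k) \<longrightarrow>
        w (b k) = subst_letter n (w (b (Suc k))) ! nat (q mod 3)"
      using letter by (intro allI impI)
    have stay: "nat (q mod 3) = 0 \<longrightarrow> b (Suc k) = b k"
      using bS by (cases q rule: mod3_cases) auto
    show ?thesis
      by (intro exI[of _ "nat (q mod 3)"] conjI) fact+
  qed
  define \<mu> where "\<mu> k = min (x (b k)) (y (b k))" for k
  have main: "x (b (Suc k)) \<noteq> y (b (Suc k)) \<and>
      (\<mu> (Suc k) < \<mu> k \<or> b (Suc k) = b k)" if "x (b k) \<noteq> y (b k)" for k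
  proof -
    obtain d where d: "d = 0 \<longrightarrow> b (Suc k) = b k" "d \<in> {0, 1, 2}"
      and letter: "\<forall>w. w \<in> aligned n (z (Suc k)) (Suc k) \<longrightarrow>
        w (b k) = subst_letter n (w (b (Suc k))) ! d"
      using step[of k] by (elim exE conjE)
    have "x (b k) = subst_letter n (x (b (Suc k))) ! d" "y (b k) = subst_letter n (y (b (Suc k))) ! d"
      by (rule letter[rule_format], rule al)+
    then show ?thesis
      using that d aligned_le[OF al(1), of "b (Suc k)"] aligned_le[OF al(2), of "b (Suc k)"]
      by (auto simp: \<mu>_def split: if_splits)
  qed
  have neq: "x (b k) \<noteq> y (b k)" for k
    by (induction k) (use diff main in \<open>auto simp: b_def\<close>)
  obtain K where K: "\<And>k. \<mu> K \<le> \<mu> k"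
    using ex_has_least_nat[of "\<lambda>_. True" 0 \<mu>] by auto
  have const: "b k = b K" if "K \<le> k" for k
    using that
  proof (induction k rule: dec_induct)
    case (step k)
    then have "\<mu> k = \<mu> K" by (simp add: \<mu>_def)
    then show ?case using main[OF neq, of k] K[of "Suc k"] step by auto
  qed simp
  have "3 ^ k dvd b K + z k" for k
  proof (cases "K \<le> k")
    case True
    then show ?thesis using b_dvd[of k] const[OF True] by simp
  next
    case False
    then have "3 ^ k dvd z K - z k" by (intro coherent_phase[of z k K, OF coh]) simp
    moreover have "3 ^ k dvd b K + z K"
      using b_dvd[of K] False dvd_trans[OF le_imp_power_dvd[of k K]] by simp
    ultimately have "3 ^ k dvd (b K + z K) - (z K - z k)" using dvd_diff by blast
    then show ?thesis by simp
  qed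
  then show ?thesis using that neq by blast
qed

lemma origin_unique:
  assumes "\<And>k. (3::int) ^ k dvd i + z k" "\<And>k. 3 ^ k dvd j + z k"
  shows "i = (j :: int)"
proof -
  have "3 ^ nat \<bar>i - j\<bar> dvd (i + z (nat \<bar>i - j\<bar>)) - (j + z (nat \<bar>i - j\<bar>))"
    by (intro dvd_diff assms)
  then have "3 ^ nat \<bar>i - j\<bar> dvd i - j" by simp
  moreover have "int (nat \<bar>i - j\<bar>) < 3 ^ nat \<bar>i - j\<bar>"
    using of_nat_less_two_power[of "nat \<bar>i - j\<bar>", where ?'a = int]
      power_mono[of "2::int" 3 "nat \<bar>i - j\<bar>"] by linarith
  ultimately show ?thesis
    using zdvd_imp_le[of "3 ^ nat \<bar>i - j\<bar>" "\<bar>i - j\<bar>"] by auto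
qed

lemma subst_shift_le:
  assumes "x \<in> subst_shift n"
  shows "x i \<le> n"
proof -
  obtain z where "x \<in> aligned n z 0" using assms by (rule subst_shift_aligned)
  then show ?thesis by (rule aligned_le)
qed

lemma limit_space_le: "x \<in> limit_space \<Longrightarrow> 1 \<le> n \<Longrightarrow> x n i \<le> n"
  by (rule subst_shift_le) (auto simp: limit_space_def)

section \<open>Sets of points with a common phase are countable\<close>

text \<open>The letters at one position satisfy \<open>x n i = min (x (n + 1) i) n\<close>, so they are the
  truncations of one element of \<open>\<nat> \<union> {\<infinity>}\<close>; here \<open>None\<close> stands for \<open>\<infinity>\<close>.\<close>

lemma limit_space_coordinate:
  assumes "x \<in> limit_space"
  obtains a where "\<And>n. 1 \<le> n \<Longrightarrow> x n i = (case a of None \<Rightarrow> n | Some b \<Rightarrow> min b n)"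
proof -
  have col: "x n i = min (x (Suc n) i) n" if "1 \<le> n" for n
  proof -
    have "x n = collapse n \<circ> x (n + 1)" using assms that by (auto simp: limit_space_def)
    then show ?thesis
      using limit_space_le[OF assms, of "Suc n" i] by (auto simp: collapse_def fun_eq_iff)
  qed
  show ?thesis
  proof (cases "\<forall>n\<ge>1. x n i = n")
    case True
    then show ?thesis using that[of None] by simp
  next
    case False
    then obtain N where N: "1 \<le> N" "x N i < N"
      using limit_space_le[OF assms] by (metis le_neq_implies_less)
    have up: "x n i = x N i" if "N \<le> n" for n
      using that
    proof (induction n rule: dec_induct)
      case (step n)
      then show ?case using col[of n] N by (auto simp: min_def split: if_splits)
    qed simp
    have down: "x n i = min (x N i) n" if "1 \<le> n" "n \<le> N" for n
      using that(2,1)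
    proof (induction n rule: inc_induct)
      case base
      then show ?case using N by simp
    next
      case (step n)
      then show ?case using col[of n] by auto
    qed
    have "x n i = min (x N i) n" if "1 \<le> n" for n
      using up[of n] down[of n] that N by (cases "N \<le> n") auto
    then show ?thesis using that[of "Some (x N i)"] by simp
  qed
qed

lemma countable_proximal:
  assumes S: "S \<subseteq> limit_space"
    and prox: "\<And>x y. x \<in> S \<Longrightarrow> y \<in> S \<Longrightarrow> share_long_words (x 1) (y 1)"
  shows "countable S"
proof (cases "\<exists>x\<in>S. \<exists>y\<in>S. x \<noteq> y")
  case False
  then have "S = {} \<or> (\<exists>x. S = {x})" by blast
  then show ?thesis by auto
next
  case True
  then obtain s t where st: "s \<in> S" "t \<in> S" "s \<noteq> t" by blast
  have "s 1 \<in> subst_shift 1" using S st by (auto simp: limit_space_def)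
  then have "\<exists>z. s 1 \<in> aligned 1 z k" for k by (meson subst_shift_aligned)
  then obtain z where z: "\<And>k. s 1 \<in> aligned 1 (z k) k" by metis
  have coh: "3 ^ k dvd z (Suc k) - z k" for k
  proof -
    have "s 1 \<in> aligned 1 (z (Suc k)) k" using z[of "Suc k"] aligned_antimono[of k "Suc k"] by auto
    then show ?thesis using phase_unique z share_long_words_refl by blast
  qed
  have al: "x n \<in> aligned n (z k) k" if "x \<in> S" "1 \<le> n" for x n k
    using limit_space_phase[of s x, OF _ _ _ z] S prox st that by blast
  have origin: "\<exists>i. (\<forall>k. 3 ^ k dvd i + z k) \<and> (\<exists>n\<ge>1. x n i \<noteq> y n i)"
    if xy: "x \<in> S" "y \<in> S" "x \<noteq> y" for x y
  proof -
    have "x \<in> extensional {1..}" "y \<in> extensional {1..}"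
      using S xy by (auto simp: limit_space_def PiE_def)
    then obtain n where n: "1 \<le> n" "x n \<noteq> y n"
      using \<open>x \<noteq> y\<close> by (metis atLeast_iff extensionalityI)
    then obtain i where "x n i \<noteq> y n i" by auto
    then obtain j where "\<And>k. 3 ^ k dvd j + z k" "x n j \<noteq> y n j"
      using origin_exists[of "x n" n z "y n" i] al[OF xy(1) n(1)] al[OF xy(2) n(1)] coh by blast
    then show ?thesis using n(1) by blast
  qed
  obtain i\<^sub>0 where i\<^sub>0: "\<And>k. 3 ^ k dvd i\<^sub>0 + z k"
    using origin[OF st] by blast
  have sep: "\<exists>n\<ge>1. x n i\<^sub>0 \<noteq> y n i\<^sub>0" if "x \<in> S" "y \<in> S" "x \<noteq> y" for x y
  proof -
    obtain i where i: "\<And>k. 3 ^ k dvd i + z k" "\<exists>n\<ge>1. x n i \<noteq> y n i"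
      using origin[OF \<open>x \<in> S\<close> \<open>y \<in> S\<close> \<open>x \<noteq> y\<close>] by blast
    then show ?thesis using origin_unique[of i z i\<^sub>0] i\<^sub>0 by simp
  qed
  have "\<forall>x\<in>S. \<exists>a. \<forall>n\<ge>1. x n i\<^sub>0 = (case a of None \<Rightarrow> n | Some b \<Rightarrow> min b n)"
    using S limit_space_coordinate by (metis subsetD)
  then obtain a where "\<And>x n. x \<in> S \<Longrightarrow> 1 \<le> n \<Longrightarrow> x n i\<^sub>0 = (case a x of None \<Rightarrow> n | Some b \<Rightarrow> min b n)"
    by metis
  then have "inj_on a S"
    using sep by (intro inj_onI) metis
  then show ?thesis by (rule countableI')
qed

section \<open>Li--Yorke pairs share long words\<close>

lemma closed_subst_shift: "closed (subst_shift n)"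
  unfolding subst_shift_def by (intro closed_Inter) (auto simp: subshift_def)

lemma compact_subst_shift: "compact (subst_shift n)"
proof -
  have "compact (PiE UNIV (\<lambda>_::int. {..n}))"
  proof -
    have "compactin (product_topology (\<lambda>_. euclidean) UNIV) (PiE UNIV (\<lambda>_::int. {..n}))"
      by (simp add: compactin_PiE finite_imp_compact)
    then show ?thesis by (simp add: euclidean_product_topology)
  qed
  moreover have "subst_shift n = PiE UNIV (\<lambda>_::int. {..n}) \<inter> subst_shift n"
    using subst_shift_le by auto
  ultimately show ?thesis using compact_Int_closed closed_subst_shift by metis
qed

lemma shift_subst_shift: "x \<in> subst_shift n \<Longrightarrow> shift x \<in> subst_shift n"
  unfolding subst_shift_def subshift_def by blast

lemma limit_map_limit_space: "x \<in> limit_space \<Longrightarrow> limit_map x \<in> limit_space"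
  by (auto simp: limit_space_def limit_map_def shift_subst_shift PiE_iff)
     (auto simp: shift_def fun_eq_iff)

lemma limit_map_iterate:
  assumes "x \<in> limit_space"
  shows "(limit_map ^^ k) x \<in> limit_space \<and> (\<forall>i. (limit_map ^^ k) x 1 i = x 1 (i + int k))"
proof (induction k)
  case (Suc k)
  then have "(limit_map ^^ Suc k) x \<in> limit_space" by (simp add: limit_map_limit_space)
  moreover have "limit_map w 1 i = w 1 (i + 1)" for w i by (simp add: limit_map_def shift_def)
  ultimately show ?case using Suc by (simp add: algebra_simps)
qed (simp add: assms)

lemma continuous_map_coordinate:
  assumes "1 \<le> n"
  shows "continuous_map (product_topology (\<lambda>n. top_of_set (subst_shift n)) {1..})
    (discrete_topology UNIV) (\<lambda>x. f (x n i :: nat))"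
proof -
  have proj: "continuous_map (product_topology (\<lambda>n. top_of_set (subst_shift n)) {1..})
      (top_of_set (subst_shift n)) (\<lambda>x. x n)"
    using assms by (intro continuous_map_product_projection) auto
  have coord: "continuous_map (top_of_set (subst_shift n)) euclidean (\<lambda>x. x i)"
    by (auto intro: continuous_on_subset[OF continuous_on_product_coordinates])
  have f: "continuous_map euclidean (discrete_topology UNIV) f"
    by (auto simp: continuous_map_def open_discrete)
  show ?thesis
    using continuous_map_compose[OF continuous_map_compose[OF proj coord] f] by (simp add: o_def)
qed

lemma compact_space_limit_topology: "compact_space limit_topology"
proof -
  let ?P = "product_topology (\<lambda>n. top_of_set (subst_shift n)) {1..}"
  have "compact_space ?P"
    by (intro compact_space_product_topology[THEN iffD2] disjI2 ballI)
       (simp add: compact_space_subtopology compactin_euclidean_iff compact_subst_shift)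
  moreover have "limit_space = (\<Inter>n\<in>{1..}. \<Inter>i. {x \<in> topspace ?P. collapse n (x (n + 1) i) = x n i})"
    by (auto simp: limit_space_def fun_eq_iff)
  moreover have "closedin ?P {x \<in> topspace ?P. collapse n (x (n + 1) i) = x n i}" if "1 \<le> n" for n i
    using that
    by (intro closedin_continuous_maps_eq[OF _ continuous_map_coordinate[of "n + 1" "collapse n" i]
          continuous_map_coordinate[of n "\<lambda>a. a" i]]) auto
  then have "closedin ?P (\<Inter>n\<in>{1..}. \<Inter>i. {x \<in> topspace ?P. collapse n (x (n + 1) i) = x n i})"
    by (intro closedin_INT) auto
  ultimately have "closedin ?P limit_space" by (simp only:)
  then show ?thesis
    unfolding limit_topology_def
    using closedin_compact_space[OF \<open>compact_space ?P\<close>] by (intro compact_space_subtopology)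
qed

lemma topspace_limit_topology: "topspace limit_topology = limit_space"
  by (auto simp: limit_topology_def limit_space_def)

text \<open>The metric is known only through its topology. Compactness makes up for this: the cylinders
  that fix a window of the first coordinate form an open cover, and its Lebesgue number is a
  uniform \<open>\<epsilon>\<close>.\<close>

lemma close_points_agree:
  assumes "Metric_space limit_space d" "Metric_space.mtopology limit_space d = limit_topology"
  obtains \<epsilon> where "\<epsilon> > 0"
    "\<And>x y i. x \<in> limit_space \<Longrightarrow> y \<in> limit_space \<Longrightarrow> d x y < \<epsilon> \<Longrightarrow> i \<in> {0..L} \<Longrightarrow> x 1 i = y 1 i"
proof -
  interpret Metric_space limit_space d by fact
  define U where "U u = {x \<in> limit_space. \<forall>i\<in>{0..L}. x 1 i = u i}" for u :: "int \<Rightarrow> nat"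
  have opn: "openin mtopology (U u)" for u
  proof -
    have "continuous_map limit_topology (discrete_topology UNIV) (\<lambda>x. x 1 i)" for i
      unfolding limit_topology_def
      using continuous_map_coordinate[of 1 "\<lambda>a. a" i] by (simp add: continuous_map_from_subtopology)
    then have "openin limit_topology {x \<in> topspace limit_topology. x 1 i \<in> {u i}}" for i
      by (rule openin_continuous_map_preimage) simp
    then have "openin limit_topology ((\<Inter>i\<in>{0..L}.
        {x \<in> topspace limit_topology. x 1 i \<in> {u i}}) \<inter> topspace limit_topology)"
      by (intro openin_INT) auto
    moreover have "(\<Inter>i\<in>{0..L}. {x \<in> topspace limit_topology. x 1 i \<in> {u i}}) \<inter>
        topspace limit_topology = U u"
      by (auto simp: U_def topspace_limit_topology)
    ultimately show ?thesis using assms(2) by simp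
  qed
  have "compactin mtopology limit_space"
    using compact_space_limit_topology assms(2) by (simp add: compact_space_def topspace_limit_topology)
  moreover have "limit_space \<subseteq> \<Union> (range U)" by (auto simp: U_def)
  ultimately obtain \<epsilon> where e: "\<epsilon> > 0" "\<And>x. x \<in> limit_space \<Longrightarrow> \<exists>V\<in>range U. mball x \<epsilon> \<subseteq> V"
    using lebesgue_number[of limit_space "range U"] opn by blast
  have "x 1 i = y 1 i" if xy: "x \<in> limit_space" "y \<in> limit_space" "d x y < \<epsilon>" "i \<in> {0..L}" for x y i
  proof -
    obtain u where "mball x \<epsilon> \<subseteq> U u" using e(2)[OF xy(1)] by blast
    then have "x \<in> U u" "y \<in> U u" using xy e(1) by auto
    then show ?thesis using xy(4) by (simp add: U_def)
  qed
  then show ?thesis using that e(1) by blast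
qed

lemma li_yorke_share_long_words:
  assumes "Metric_space limit_space d" "Metric_space.mtopology limit_space d = limit_topology"
    and ly: "li_yorke_pair limit_space d limit_map x y"
  shows "share_long_words (x 1) (y 1)"
  unfolding share_long_words_def
proof
  fix L :: int
  have xy: "x \<in> limit_space" "y \<in> limit_space"
    and lim: "liminf (\<lambda>k. ereal (d ((limit_map ^^ k) x) ((limit_map ^^ k) y))) = 0"
    using ly by (auto simp: li_yorke_pair_def)
  obtain \<epsilon> where e: "\<epsilon> > 0"
    "\<And>x y i. x \<in> limit_space \<Longrightarrow> y \<in> limit_space \<Longrightarrow> d x y < \<epsilon> \<Longrightarrow> i \<in> {0..L} \<Longrightarrow> x 1 i = y 1 i"
    using close_points_agree[OF assms(1,2)] by metis
  have "\<exists>k. d ((limit_map ^^ k) x) ((limit_map ^^ k) y) < \<epsilon>"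
  proof (rule ccontr)
    assume "\<not> ?thesis"
    then have "ereal \<epsilon> \<le> liminf (\<lambda>k. ereal (d ((limit_map ^^ k) x) ((limit_map ^^ k) y)))"
      by (intro Liminf_bounded) (simp add: not_less)
    then show False using lim \<open>\<epsilon> > 0\<close> by simp
  qed
  then obtain k where k: "d ((limit_map ^^ k) x) ((limit_map ^^ k) y) < \<epsilon>" by blast
  have "x 1 i = y 1 i" if "i \<in> {int k..int k + L}" for i
    using e(2)[OF _ _ k, of "i - int k"] that limit_map_iterate[OF xy(1), of k]
      limit_map_iterate[OF xy(2), of k] by simp
  then show "\<exists>p. \<forall>i\<in>{p..p + L}. x 1 i = y 1 i" by blast
qed

theorem mainTheorem16:
  fixes d :: "(nat \<Rightarrow> int \<Rightarrow> nat) \<Rightarrow> (nat \<Rightarrow> int \<Rightarrow> nat) \<Rightarrow> real"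
    and S :: "(nat \<Rightarrow> int \<Rightarrow> nat) set"
  assumes "Metric_space limit_space d"
    and "Metric_space.mtopology limit_space d = limit_topology"
    and "scrambled limit_space d limit_map S"
  shows "countable S"
proof (rule countable_proximal)
  show "S \<subseteq> limit_space" using assms(3) by (simp add: scrambled_def)
  show "share_long_words (x 1) (y 1)" if "x \<in> S" "y \<in> S" for x y
    using li_yorke_share_long_words[OF assms(1,2), of x y] share_long_words_refl assms(3) that
    by (cases "x = y") (auto simp: scrambled_def)
qed

end
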